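(* Let $n \geq 1$ be a fixed integer. Then $$B_n^{(m)} \sim \frac{n!}{2^{n-1}}\, m^{n-1} \quad (m \to \infty),$$ i.e. $\lim_{m\to\infty} B_n^{(m)} \big/ \left(\frac{n!}{2^{n-1}} m^{n-1}\right) = 1$.
   Context: For integers $m,n \geq 0$, the $m$-th order Bell numbers $B_n^{(m)}$ are defined by the exponential generating functions $E_m(x) = \sum_{n=0}^\infty B_n^{(m)} \frac{x^n}{n!}$, where $E_0(x) = \exp(x)$ and $E_{m+1}(x) = \exp(E_m(x) - 1)$ for $m \geq 0$. *)

theory Defs
  imports
    "HOL-Computational_Algebra.Formal_Power_Series"
    "HOL-Library.Landau_Symbols"
begin

(* fps_compose is the substitution of power series only if the inner series has
   constant term 0; bell_egf_nth_0 below ensures this for bell_egf m - 1. *)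
primrec bell_egf :: "nat \<Rightarrow> real fps" where
  "bell_egf 0 = fps_exp 1"
| "bell_egf (Suc m) = fps_exp 1 oo (bell_egf m - 1)"

lemma bell_egf_nth_0 [simp]: "fps_nth (bell_egf m) 0 = 1"
  by (induction m) simp_all

definition bell_number :: "nat \<Rightarrow> nat \<Rightarrow> real" where
  "bell_number m n = fact n * fps_nth (bell_egf m) n"

end

theory Submission imports Defs begin

text \<open>
  Put \<open>E\<^sub>m = 1 + x H\<^sub>m\<close>. Expanding \<open>exp (E\<^sub>m - 1)\<close> shows that the coefficient of \<open>x\<^sup>N\<^sup>+\<^sup>1\<close> in
  \<open>H\<^sub>m\<^sub>+\<^sub>1 - H\<^sub>m\<close> is the sum over \<open>i \<le> N\<close> of the coefficients of \<open>x\<^sup>N\<^sup>-\<^sup>i\<close> in \<open>H\<^sub>m\<^sup>i\<^sup>+\<^sup>2 / (i + 2)!\<close>,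
  which only involves lower coefficients of \<open>H\<^sub>m\<close>. By induction the coefficient of \<open>x\<^sup>j\<close> in
  \<open>H\<^sub>m\<close> is asymptotic to that in \<open>1 / (1 - m x / 2)\<close>. So the \<open>i\<close>-th summand is of order
  \<open>m\<^sup>N\<^sup>-\<^sup>i\<close>, only \<open>i = 0\<close> matters, and it contributes \<open>(N + 1) (m / 2)\<^sup>N / 2\<close>. Summation over
  \<open>m\<close> by the Stolz--Cesaro theorem gives \<open>(m / 2)\<^sup>N\<^sup>+\<^sup>1\<close>.
\<close>

text \<open>Eventually each increment of \<open>u\<close> is at most \<open>e / 2\<close> times that
  of \<open>v\<close>. Telescoping bounds \<open>u\<close> by a constant plus
  \<open>e / 2 * v n\<close>, and the growth of \<open>v\<close> absorbs the constant.\<close>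

lemma Stolz_Cesaro_0:
  fixes u v :: "nat \<Rightarrow> real"
  assumes v: "strict_mono v" "filterlim v at_top sequentially"
    and lim: "(\<lambda>n. (u (Suc n) - u n) / (v (Suc n) - v n)) \<longlonglongrightarrow> 0"
  shows "(\<lambda>n. u n / v n) \<longlonglongrightarrow> 0"
proof (rule tendstoI)
  fix e :: real assume e: "e > 0"
  have v_less: "v n < v (Suc n)" for n
    using v(1) by (simp add: strict_mono_def)
  from e have "eventually (\<lambda>n. \<bar>(u (Suc n) - u n) / (v (Suc n) - v n)\<bar> < e / 2) sequentially"
    using tendstoD[OF lim, of "e / 2"] by (simp add: dist_real_def)
  then obtain M where M: "\<bar>(u (Suc n) - u n) / (v (Suc n) - v n)\<bar> < e / 2" if "n \<ge> M" for n
    by (auto simp: eventually_sequentially)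
  have step: "\<bar>u (Suc n) - u n\<bar> \<le> e / 2 * (v (Suc n) - v n)" if "n \<ge> M" for n
    using M[OF that] v_less[of n] by (simp add: pos_divide_less_eq)
  have bound: "\<bar>u n\<bar> \<le> \<bar>u M\<bar> + e / 2 * (v n - v M)" if "n \<ge> M" for n
    using that
  proof (induction n rule: dec_induct)
    case (step n)
    then show ?case
      using \<open>\<And>n. n \<ge> M \<Longrightarrow> \<bar>u (Suc n) - u n\<bar> \<le> e / 2 * (v (Suc n) - v n)\<close>[of n]
      by (simp add: right_diff_distrib)
  qed simp
  define C where "C = \<bar>u M\<bar> - e / 2 * v M"
  \<comment> \<open>The bound \<open>2 * C / e\<close> yields \<open>C < e / 2 * v n\<close>; the
    maximum with 0 makes \<open>v n\<close> positive.\<close>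
  have "eventually (\<lambda>n. v n > max 0 (2 * C / e)) sequentially"
    using v(2) unfolding filterlim_at_top_dense by blast
  then show "eventually (\<lambda>n. dist (u n / v n) 0 < e) sequentially"
    using eventually_ge_at_top[of M]
  proof eventually_elim
    case (elim n)
    then have "v n > 0" "C < e / 2 * v n"
      using e by (simp_all add: field_simps)
    moreover have "\<bar>u n\<bar> \<le> C + e / 2 * v n"
      using bound[of n] elim by (simp add: C_def right_diff_distrib)
    ultimately have "\<bar>u n\<bar> < e * v n"
      by simp
    then show ?case
      using \<open>v n > 0\<close> by (simp add: pos_divide_less_eq)
  qed
qed

text \<open>Replacing \<open>u\<close> by \<open>u - l * v\<close> reduces this to limit 0.\<close>

lemma Stolz_Cesaro:
  fixes u v :: "nat \<Rightarrow> real"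
  assumes v: "strict_mono v" "filterlim v at_top sequentially"
    and lim: "(\<lambda>n. (u (Suc n) - u n) / (v (Suc n) - v n)) \<longlonglongrightarrow> l"
  shows "(\<lambda>n. u n / v n) \<longlonglongrightarrow> l"
proof -
  have v_ne: "v (Suc n) - v n \<noteq> 0" for n
    using strict_monoD[OF v(1), of n "Suc n"] by simp
  have "(\<lambda>n. (u (Suc n) - u n) / (v (Suc n) - v n) - l) \<longlonglongrightarrow> 0"
    using tendsto_diff[OF lim tendsto_const[of l]] by simp
  also have "(\<lambda>n. (u (Suc n) - u n) / (v (Suc n) - v n) - l) =
    (\<lambda>n. ((u (Suc n) - l * v (Suc n)) - (u n - l * v n)) / (v (Suc n) - v n))"
    using v_ne by (simp add: fun_eq_iff field_simps)
  finally have "(\<lambda>n. (u n - l * v n) / v n) \<longlonglongrightarrow> 0"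
    by (rule Stolz_Cesaro_0[OF v])
  then have "(\<lambda>n. (u n - l * v n) / v n + l) \<longlonglongrightarrow> l"
    using tendsto_add[OF _ tendsto_const[of l]] by fastforce
  moreover have "eventually (\<lambda>n. v n > 0) sequentially"
    using v(2) by (simp add: filterlim_at_top_dense)
  then have "eventually (\<lambda>n. (u n - l * v n) / v n + l = u n / v n) sequentially"
    by eventually_elim (simp add: field_simps)
  ultimately show ?thesis
    by (rule Lim_transform_eventually)
qed

text \<open>The quotient is the difference quotient of \<open>x ^ Suc N\<close> at 1 with increment
  \<open>1 / m\<close>, so it tends to the derivative there.\<close>

lemma power_Suc_diff_asymptotics:
  "(\<lambda>m. (real (Suc m) ^ Suc N - real m ^ Suc N) / real m ^ N) \<longlonglongrightarrow> real (Suc N)"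
proof -
  have "((\<lambda>x::real. x ^ Suc N) has_field_derivative real (Suc N)) (at 1)"
    by (auto intro!: derivative_eq_intros)
  then have deriv: "((\<lambda>h::real. ((1 + h) ^ Suc N - 1) / h) \<longlongrightarrow> real (Suc N)) (at 0)"
    by (simp add: DERIV_def)
  have "filterlim (\<lambda>m. 1 / real m) (at 0) sequentially"
    unfolding filterlim_at using lim_1_over_n eventually_gt_at_top[of 0]
    by (auto elim!: eventually_mono)
  from filterlim_compose[OF deriv this]
  have "(\<lambda>m. ((1 + 1 / real m) ^ Suc N - 1) / (1 / real m)) \<longlonglongrightarrow> real (Suc N)" .
  moreover have "eventually (\<lambda>m. ((1 + 1 / real m) ^ Suc N - 1) / (1 / real m) =
      (real (Suc m) ^ Suc N - real m ^ Suc N) / real m ^ N) sequentially"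
    using eventually_gt_at_top[of 0]
  proof eventually_elim
    case (elim m)
    then have "1 + 1 / real m = real (Suc m) / real m"
      by (simp add: field_simps)
    then show ?case
      using elim by (simp add: field_simps)
  qed
  ultimately show ?thesis
    by (rule Lim_transform_eventually)
qed

lemma polynomial_growth_of_differences:
  fixes u :: "nat \<Rightarrow> real"
  assumes "(\<lambda>m. (u (Suc m) - u m) / real m ^ N) \<longlonglongrightarrow> c * real (Suc N)"
  shows "(\<lambda>m. u m / real m ^ Suc N) \<longlonglongrightarrow> c"
proof (rule Stolz_Cesaro)
  show "strict_mono (\<lambda>m. real m ^ Suc N)"
    by (intro strict_monoI power_strict_mono) auto
  show "filterlim (\<lambda>m. real m ^ Suc N) at_top sequentially"
    by (intro filterlim_pow_at_top filterlim_real_sequentially) auto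
  \<comment> \<open>Both differences are divided by \<open>m ^ N\<close> so that each has a limit of
    its own.\<close>
  have "(\<lambda>m. ((u (Suc m) - u m) / real m ^ N) /
      ((real (Suc m) ^ Suc N - real m ^ Suc N) / real m ^ N)) \<longlonglongrightarrow> c * real (Suc N) / real (Suc N)"
    by (intro tendsto_divide assms power_Suc_diff_asymptotics) simp
  then have "(\<lambda>m. ((u (Suc m) - u m) / real m ^ N) /
      ((real (Suc m) ^ Suc N - real m ^ Suc N) / real m ^ N)) \<longlonglongrightarrow> c"
    by (simp del: of_nat_Suc)
  moreover have "eventually (\<lambda>m. ((u (Suc m) - u m) / real m ^ N) /
      ((real (Suc m) ^ Suc N - real m ^ Suc N) / real m ^ N) =
      (u (Suc m) - u m) / (real (Suc m) ^ Suc N - real m ^ Suc N)) sequentially"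
    using eventually_gt_at_top[of 0] by eventually_elim simp
  ultimately show "(\<lambda>m. (u (Suc m) - u m) / (real (Suc m) ^ Suc N - real m ^ Suc N)) \<longlonglongrightarrow> c"
    by (rule Lim_transform_eventually)
qed

text \<open>Dividing the coefficient of degree \<open>j\<close> by \<open>m ^ j\<close> is the
  substitution of \<open>x / m\<close> for \<open>x\<close>, which respects products; each
  coefficient of a product is a finite sum.\<close>

lemma scaled_fps_mult_tendsto:
  fixes f g :: "nat \<Rightarrow> real fps"
  assumes "\<And>j. j \<le> N \<Longrightarrow> (\<lambda>m. fps_nth (f m) j / real m ^ j) \<longlonglongrightarrow> fps_nth F j"
    and "\<And>j. j \<le> N \<Longrightarrow> (\<lambda>m. fps_nth (g m) j / real m ^ j) \<longlonglongrightarrow> fps_nth G j"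
  shows "(\<lambda>m. fps_nth (f m * g m) N / real m ^ N) \<longlonglongrightarrow> fps_nth (F * G) N"
proof -
  have "(\<lambda>m. \<Sum>i=0..N. (fps_nth (f m) i / real m ^ i) * (fps_nth (g m) (N - i) / real m ^ (N - i)))
    \<longlonglongrightarrow> (\<Sum>i=0..N. fps_nth F i * fps_nth G (N - i))"
    by (intro tendsto_sum tendsto_mult assms) auto
  also have "(\<lambda>m. \<Sum>i=0..N. (fps_nth (f m) i / real m ^ i) * (fps_nth (g m) (N - i) / real m ^ (N - i)))
    = (\<lambda>m. fps_nth (f m * g m) N / real m ^ N)"
    by (auto simp: fun_eq_iff fps_mult_nth sum_divide_distrib power_add[symmetric] intro!: sum.cong)
  finally show ?thesis
    by (simp add: fps_mult_nth)
qed

lemma scaled_fps_power_tendsto: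
  fixes f :: "nat \<Rightarrow> real fps"
  assumes "\<And>j. j \<le> N \<Longrightarrow> (\<lambda>m. fps_nth (f m) j / real m ^ j) \<longlonglongrightarrow> fps_nth F j"
  shows "(\<lambda>m. fps_nth (f m ^ k) N / real m ^ N) \<longlonglongrightarrow> fps_nth (F ^ k) N"
  using assms
proof (induction k arbitrary: N)
  case 0
  show ?case
    by (rule tendsto_eventually) simp
next
  case (Suc k)
  show ?case
    unfolding power_Suc by (intro scaled_fps_mult_tendsto Suc) auto
qed

text \<open>This is \<open>H\<^sub>m\<close> of the overview. Removing one factor \<open>x\<close>
  makes the degree of a coefficient equal to its order of growth in \<open>m\<close>.\<close>

definition bell_quot :: "nat \<Rightarrow> real fps" where
  "bell_quot m = fps_shift 1 (bell_egf m)"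

lemma bell_egf_minus_1: "bell_egf m - 1 = fps_X * bell_quot m"
  by (rule fps_ext) (simp add: bell_quot_def)

lemma bell_egf_minus_1_power_nth:
  "fps_nth ((bell_egf m - 1) ^ k) n = (if n < k then 0 else fps_nth (bell_quot m ^ k) (n - k))"
  by (simp add: bell_egf_minus_1 power_mult_distrib fps_X_power_mult_nth)

lemma bell_quot_Suc_nth:
  "fps_nth (bell_quot (Suc m)) n = (\<Sum>i\<le>n. fps_nth (bell_quot m ^ Suc i) (n - i) / fact (Suc i))"
proof -
  have "fps_nth (bell_quot (Suc m)) n =
      (\<Sum>i=0..Suc n. fps_nth ((bell_egf m - 1) ^ i) (Suc n) / fact i)"
    by (simp add: bell_quot_def fps_compose_nth)
  also have "\<dots> = (\<Sum>i=Suc 0..Suc n. fps_nth ((bell_egf m - 1) ^ i) (Suc n) / fact i)"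
    by (subst sum.atLeast_Suc_atMost) simp_all
  also have "\<dots> = (\<Sum>i=0..n. fps_nth ((bell_egf m - 1) ^ Suc i) (Suc n) / fact (Suc i))"
    by (subst sum.shift_bounds_cl_Suc_ivl) simp
  also have "\<dots> = (\<Sum>i\<le>n. fps_nth (bell_quot m ^ Suc i) (n - i) / fact (Suc i))"
    unfolding bell_egf_minus_1_power_nth by (intro sum.cong) auto
  finally show ?thesis .
qed

lemma bell_quot_nth_0: "fps_nth (bell_quot m) 0 = 1"
proof (induction m)
  case 0
  then show ?case by (simp add: bell_quot_def)
next
  case (Suc m)
  then show ?case by (simp add: bell_quot_Suc_nth)
qed

text \<open>The first summand of the recursion is the coefficient of \<open>bell_quot m\<close>
  itself and cancels.\<close>

lemma bell_quot_diff_nth: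
  "fps_nth (bell_quot (Suc m)) (Suc N) - fps_nth (bell_quot m) (Suc N) =
   (\<Sum>i\<le>N. fps_nth (bell_quot m ^ (i + 2)) (N - i) / fact (i + 2))"
  unfolding bell_quot_Suc_nth[of m "Suc N"] sum.atMost_Suc_shift by simp

lemma bell_quot_nth_tendsto:
  "(\<lambda>m. fps_nth (bell_quot m) n / real m ^ n) \<longlonglongrightarrow> (1 / 2) ^ n"
proof (induction n rule: less_induct)
  case (less n)
  show ?case
  proof (cases n)
    case 0
    then show ?thesis by (simp add: bell_quot_nth_0)
  next
    case (Suc N)
    \<comment> \<open>\<open>G\<close> is the series of \<open>1 / (1 - x / 2)\<close>, the expected
      limit after rescaling.\<close>
    define G :: "real fps" where "G = Abs_fps (\<lambda>n. (1 / 2) ^ n)"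
    have conv: "(\<lambda>m. fps_nth (bell_quot m ^ k) j / real m ^ j) \<longlonglongrightarrow> fps_nth (G ^ k) j" if "j \<le> N" for j k
      using that Suc less by (intro scaled_fps_power_tendsto) (auto simp: G_def)
    have summand: "(\<lambda>m. fps_nth (bell_quot m ^ (i + 2)) (N - i) / fact (i + 2) / real m ^ N)
        \<longlonglongrightarrow> (if i = 0 then fps_nth (G ^ 2) N / 2 else 0)" if i: "i \<le> N" for i
    proof -
      \<comment> \<open>Splitting \<open>m ^ N\<close> as \<open>m ^ (N - i) * m ^ i\<close> leaves
        this factor; its limit \<open>0 ^ i\<close> is 1 for \<open>i = 0\<close> and 0
        otherwise.\<close>
      have inverse_power: "(\<lambda>m. inverse (real m) ^ i) \<longlonglongrightarrow> 0 ^ i"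
        by (intro tendsto_power lim_inverse_n)
      have "(\<lambda>m. (fps_nth (bell_quot m ^ (i + 2)) (N - i) / real m ^ (N - i)) * inverse (real m) ^ i
          / fact (i + 2)) \<longlonglongrightarrow> fps_nth (G ^ (i + 2)) (N - i) * 0 ^ i / fact (i + 2)"
        by (rule tendsto_divide[OF tendsto_mult[OF conv inverse_power] tendsto_const]) simp_all
      moreover have "(fps_nth (bell_quot m ^ (i + 2)) (N - i) / real m ^ (N - i)) * inverse (real m) ^ i
          / fact (i + 2) = fps_nth (bell_quot m ^ (i + 2)) (N - i) / fact (i + 2) / real m ^ N" for m
        using i power_add[of "real m" "N - i" i]
        by (simp add: power_inverse divide_inverse mult_ac)
      moreover have "fps_nth (G ^ (i + 2)) (N - i) * 0 ^ i / fact (i + 2) =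
          (if i = 0 then fps_nth (G ^ 2) N / 2 else 0)"
        by (simp add: numeral_2_eq_2)
      ultimately show ?thesis by (simp only:)
    qed
    have G2: "fps_nth (G ^ 2) N = real (Suc N) * (1 / 2) ^ N"
      by (simp add: power2_eq_square fps_mult_nth G_def power_add[symmetric])
    have "(\<lambda>m. \<Sum>i\<le>N. fps_nth (bell_quot m ^ (i + 2)) (N - i) / fact (i + 2) / real m ^ N)
        \<longlonglongrightarrow> (\<Sum>i\<le>N. if i = 0 then fps_nth (G ^ 2) N / 2 else 0)"
      by (intro tendsto_sum summand) auto
    \<comment> \<open>The factor \<open>1 / 2\<close> from \<open>fact 2\<close> raises the exponent
      to \<open>Suc N\<close>, so the growth lemma applies with
      \<open>c = (1 / 2) ^ Suc N\<close>.\<close>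
    then have "(\<lambda>m. (fps_nth (bell_quot (Suc m)) (Suc N) - fps_nth (bell_quot m) (Suc N)) / real m ^ N)
        \<longlonglongrightarrow> (1 / 2) ^ Suc N * real (Suc N)"
      unfolding bell_quot_diff_nth sum_divide_distrib by (simp add: G2 mult_ac)
    from polynomial_growth_of_differences[OF this] show ?thesis
      by (simp only: Suc)
  qed
qed

theorem theorem1:
  fixes n :: nat
  assumes "n \<ge> 1"
  shows "(\<lambda>m. bell_number m n) \<sim>[sequentially]
           (\<lambda>m. fact n / 2 ^ (n - 1) * real m ^ (n - 1))"
proof (rule asymp_equivI'_const)
  have "(\<lambda>m. fact n * (fps_nth (bell_quot m) (n - 1) / real m ^ (n - 1)))
      \<longlonglongrightarrow> fact n * (1 / 2) ^ (n - 1)"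
    by (intro tendsto_mult tendsto_const bell_quot_nth_tendsto)
  \<comment> \<open>The shift sends degree \<open>n - 1\<close> back to \<open>n\<close> only
    because \<open>n \<ge> 1\<close>.\<close>
  moreover from assms have "fact n * (fps_nth (bell_quot m) (n - 1) / real m ^ (n - 1)) =
      bell_number m n / real m ^ (n - 1)" for m
    by (simp add: bell_number_def bell_quot_def)
  moreover have "fact n * (1 / 2) ^ (n - 1) = (fact n / 2 ^ (n - 1) :: real)"
    by (simp add: power_one_over)
  ultimately show "(\<lambda>m. bell_number m n / real m ^ (n - 1)) \<longlonglongrightarrow> fact n / 2 ^ (n - 1)"
    by (simp only:)
qed simp

end
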